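(* Let $X$ be a Banach space and $\mathcal I$ an ideal on $\mathbb N$. The map $$\Psi\colon B(X,c_{0,\mathcal I})\to c_{0,\mathcal I}^{w^*}(X^* ),\qquad T\mapsto(\alpha_n^* )_{n},\quad \alpha_n^*=\pi_n\circ T,$$ is an onto linear isometry. Moreover, if $X$ is infinite dimensional and $\mathcal I\neq\mathsf{Fin}$, then $\Psi(K(X,c_{0,\mathcal I}))\subsetneq c_{0,\mathcal I}(X^* )$.
   Context: An ideal on $\mathbb N$ is a collection of subsets of $\mathbb N$ containing $\emptyset$, closed under subsets and finite unions; every ideal is assumed to contain $\mathsf{Fin}$, the ideal of finite subsets of $\mathbb N$. For a Banach space $Z$, $c_{0,\mathcal I}(Z)$ is the closed subspace of $\ell_\infty(Z)$ (bounded sequences in $Z$, sup norm) of all $(z_n)$ with $\{n:\|z_n\|\ge\varepsilon\}\in\mathcal I$ for every $\varepsilon>0$; $c_{0,\mathcal I}$ is the case where $Z$ is the scalar field. $\pi_n\colon c_{0,\mathcal I}\to\mathbb K$ is the $n$-th coordinate projection. $B(X,Y)$ is the space of bounded linear operators with the operator norm and $K(X,Y)$ the subspace of compact operators. $c_{0,\mathcal I}^{w^*}(X^* )$ is the (closed) subspace of $\ell_\infty(X^* )$ with the sup norm consisting of all $(x_n^* )$ such that $\mathcal I\text{-}\lim_n x_n^*(x)=0$ for every $x\in X$, i.e. $\{n:|x_n^*(x)|\ge\varepsilon\}\in\mathcal I$ for every $\varepsilon>0$ and $x\in X$. *)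

theory Defs
  imports "HOL-Analysis.Analysis"
begin

text \<open>
  The scalar field is a type \<open>'k :: {real_normed_field, euclidean_space}\<close>. Both \<open>real\<close> and
  \<open>complex\<close> are instances, and up to isometric isomorphism there are no others: if
  \<open>norm z = 1\<close> and \<open>z\<close> is orthogonal to \<open>1\<close>, then
  \<open>norm (1 - z * z) = norm (1 - z) * norm (1 + z) = 2 = norm 1 + norm (z * z)\<close>, whence \<open>z * z = -1\<close>.

  The library only has real normed spaces. A normed space over \<open>'k\<close> is therefore a real normed
  space together with a multiplication by scalars from \<open>'k\<close> that extends the real one and for which
  the norm is homogeneous; it is a Banach space over \<open>'k\<close> if its type has class \<open>banach\<close>.
\<close>

locale normed_space_over = vector_space sm
  for sm :: "'k::{real_normed_field,euclidean_space} \<Rightarrow> 'x::real_normed_vector \<Rightarrow> 'x" +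
  assumes norm_sm: "norm (sm c x) = norm c * norm x"
    and sm_of_real: "sm (of_real r) x = r *\<^sub>R x"

definition infinite_dim :: "('k::field \<Rightarrow> 'x::ab_group_add \<Rightarrow> 'x) \<Rightarrow> bool" where
  "infinite_dim sm \<longleftrightarrow> \<not> (\<exists>B. finite B \<and> module.span sm B = UNIV)"

definition ideal_on_nat :: "nat set set \<Rightarrow> bool" where
  "ideal_on_nat I \<longleftrightarrow> {} \<in> I \<and> (\<forall>A\<in>I. \<forall>B. B \<subseteq> A \<longrightarrow> B \<in> I) \<and> (\<forall>A\<in>I. \<forall>B\<in>I. A \<union> B \<in> I)
     \<and> {A. finite A} \<subseteq> I"

text \<open>
  As \<open>nat\<close> is discrete, \<open>nat \<Rightarrow>\<^sub>C 'z\<close> is the space of all bounded sequences in \<open>'z\<close> with the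
  supremum norm.
\<close>

definition seq_scale :: "('k \<Rightarrow> 'z \<Rightarrow> 'z) \<Rightarrow> 'k \<Rightarrow> (nat \<Rightarrow>\<^sub>C 'z::real_normed_vector) \<Rightarrow> (nat \<Rightarrow>\<^sub>C 'z)" where
  "seq_scale sm c f = Bcontfun (\<lambda>n. sm c (apply_bcontfun f n))"

definition op_scale :: "('k \<Rightarrow> 'y \<Rightarrow> 'y) \<Rightarrow> 'k \<Rightarrow> ('x::real_normed_vector \<Rightarrow>\<^sub>L 'y::real_normed_vector) \<Rightarrow> ('x \<Rightarrow>\<^sub>L 'y)" where
  "op_scale sm c T = Blinfun (\<lambda>x. sm c (T x))"

text \<open>
  The operators below are linear over \<open>'k\<close>; a target \<open>Y\<close> or \<open>Z\<close> is a subspace of the ambient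
  normed space, given by its carrier set. The norm of \<open>\<Rightarrow>\<^sub>L\<close> is the operator norm.
\<close>

definition bounded_ops :: "('k::field \<Rightarrow> 'x \<Rightarrow> 'x) \<Rightarrow> ('k \<Rightarrow> 'y \<Rightarrow> 'y) \<Rightarrow> 'y set
    \<Rightarrow> ('x::real_normed_vector \<Rightarrow>\<^sub>L 'y::real_normed_vector) set" where
  "bounded_ops smx smy Y = {T. Vector_Spaces.linear smx smy (blinfun_apply T) \<and> range (blinfun_apply T) \<subseteq> Y}"

text \<open>\<open>Y \<inter> closure S\<close> is the closure of \<open>S\<close> in \<open>Y\<close>.\<close>

definition compact_ops :: "('k::field \<Rightarrow> 'x \<Rightarrow> 'x) \<Rightarrow> ('k \<Rightarrow> 'y \<Rightarrow> 'y) \<Rightarrow> 'y set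
    \<Rightarrow> ('x::real_normed_vector \<Rightarrow>\<^sub>L 'y::real_normed_vector) set" where
  "compact_ops smx smy Y = {T \<in> bounded_ops smx smy Y. compact (Y \<inter> closure (blinfun_apply T ` cball 0 1))}"

definition dual :: "('k \<Rightarrow> 'x \<Rightarrow> 'x) \<Rightarrow> ('x::real_normed_vector \<Rightarrow>\<^sub>L 'k::real_normed_field) set" where
  "dual sm = bounded_ops sm (*) UNIV"

definition c0_ideal :: "nat set set \<Rightarrow> 'z set \<Rightarrow> (nat \<Rightarrow>\<^sub>C 'z::real_normed_vector) set" where
  "c0_ideal I Z = {f. (\<forall>n. apply_bcontfun f n \<in> Z) \<and> (\<forall>\<epsilon>>0. {n. norm (apply_bcontfun f n) \<ge> \<epsilon>} \<in> I)}"

definition c0_ideal_wstar :: "('k \<Rightarrow> 'x \<Rightarrow> 'x) \<Rightarrow> nat set set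
    \<Rightarrow> (nat \<Rightarrow>\<^sub>C ('x::real_normed_vector \<Rightarrow>\<^sub>L 'k::real_normed_field)) set" where
  "c0_ideal_wstar sm I = {f. (\<forall>n. apply_bcontfun f n \<in> dual sm) \<and> (\<forall>x. \<forall>\<epsilon>>0. {n. norm (blinfun_apply (apply_bcontfun f n) x) \<ge> \<epsilon>} \<in> I)}"

definition coord :: "nat \<Rightarrow> (nat \<Rightarrow>\<^sub>C 'z::real_normed_vector) \<Rightarrow>\<^sub>L 'z" where
  "coord n = Blinfun (\<lambda>f. apply_bcontfun f n)"

definition Psi :: "('x::real_normed_vector \<Rightarrow>\<^sub>L (nat \<Rightarrow>\<^sub>C 'z::real_normed_vector)) \<Rightarrow> (nat \<Rightarrow>\<^sub>C ('x \<Rightarrow>\<^sub>L 'z))" where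
  "Psi T = Bcontfun (\<lambda>n. coord n o\<^sub>L T)"

definition onto_linear_isometry :: "('k \<Rightarrow> 'v \<Rightarrow> 'v) \<Rightarrow> ('k \<Rightarrow> 'w \<Rightarrow> 'w) \<Rightarrow> 'v set \<Rightarrow> 'w set
    \<Rightarrow> ('v::real_normed_vector \<Rightarrow> 'w::real_normed_vector) \<Rightarrow> bool" where
  "onto_linear_isometry smv smw V W F \<longleftrightarrow>
     (\<forall>u\<in>V. \<forall>v\<in>V. F (u + v) = F u + F v) \<and>
     (\<forall>c. \<forall>v\<in>V. F (smv c v) = smw c (F v)) \<and>
     (\<forall>v\<in>V. norm (F v) = norm v) \<and>
     F ` V = W"

text \<open>
  \<open>Bcontfun\<close> and \<open>Blinfun\<close> are unspecified on unbounded arguments. The following facts show that this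
  case does not arise, and that the scalar multiplications again give normed spaces over \<open>'k\<close>.
\<close>

lemma Bcontfun_nat:
  fixes g :: "nat \<Rightarrow> 'z::real_normed_vector"
  assumes "\<And>n. norm (g n) \<le> b"
  shows "apply_bcontfun (Bcontfun g) = g"
proof -
  have "g \<in> bcontfun"
    using assms by (auto simp: bcontfun_def bounded_iff)
  then show ?thesis by (rule Bcontfun_inverse)
qed

lemma coord_apply: "blinfun_apply (coord n) f = apply_bcontfun f n"
proof -
  have "bounded_linear (\<lambda>f :: nat \<Rightarrow>\<^sub>C 'a. apply_bcontfun f n)"
    by (rule bounded_linear_intro[where K=1]) (auto simp: norm_bounded)
  then show ?thesis by (simp add: coord_def bounded_linear_Blinfun_apply)
qed

lemma norm_coord_le: "norm (coord n) \<le> 1"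
  by (rule norm_blinfun_bound) (auto simp: coord_apply norm_bounded)

lemma Psi_apply: "apply_bcontfun (Psi T) n = coord n o\<^sub>L T"
proof -
  have "norm (coord m o\<^sub>L T) \<le> norm T" for m
  proof -
    have "norm (coord m o\<^sub>L T) \<le> norm (coord m :: (nat \<Rightarrow>\<^sub>C 'b) \<Rightarrow>\<^sub>L 'b) * norm T"
      by (rule norm_blinfun_compose)
    also have "\<dots> \<le> 1 * norm T"
      by (intro mult_right_mono norm_coord_le) auto
    finally show ?thesis by simp
  qed
  then show ?thesis unfolding Psi_def by (subst Bcontfun_nat) auto
qed

lemma normed_space_over_times: "normed_space_over ((*) :: 'k::{real_normed_field,euclidean_space} \<Rightarrow> 'k \<Rightarrow> 'k)"
  by unfold_locales (auto simp: algebra_simps norm_mult scaleR_conv_of_real)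

context normed_space_over
begin

lemma seq_scale_apply: "apply_bcontfun (seq_scale sm c f) n = sm c (apply_bcontfun f n)"
proof -
  have "norm (sm c (apply_bcontfun f m)) \<le> norm c * norm f" for m
    by (simp add: norm_sm mult_left_mono norm_bounded)
  then show ?thesis unfolding seq_scale_def by (subst Bcontfun_nat) auto
qed

lemma bounded_linear_sm: "bounded_linear (sm c)"
proof (rule bounded_linear_intro[where K="norm c"])
  fix r x
  show "sm c (r *\<^sub>R x) = r *\<^sub>R sm c x"
    by (metis mult.commute scale_scale sm_of_real)
qed (auto simp: scale_right_distrib norm_sm mult.commute)

lemma op_scale_apply: "blinfun_apply (op_scale sm c T) x = sm c (T x)"
proof -
  have "bounded_linear (\<lambda>x. sm c (T x))"
    by (rule bounded_linear_compose[OF bounded_linear_sm blinfun.bounded_linear_right])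
  then show ?thesis by (simp add: op_scale_def bounded_linear_Blinfun_apply)
qed

lemma normed_space_over_seq_scale: "normed_space_over (seq_scale sm)"
proof
  fix c :: 'k and f :: "nat \<Rightarrow>\<^sub>C 'x"
  have le: "norm (seq_scale sm c f) \<le> norm c * norm f" for c f
    by (rule norm_bound) (simp add: seq_scale_apply norm_sm mult_left_mono norm_bounded)
  show "norm (seq_scale sm c f) = norm c * norm f"
  proof (cases "c = 0")
    case True
    then show ?thesis using le[of c f] by simp
  next
    case False
    have "f = seq_scale sm (inverse c) (seq_scale sm c f)"
      using False by (intro bcontfun_eqI) (simp add: seq_scale_apply)
    then have "norm f \<le> inverse (norm c) * norm (seq_scale sm c f)"
      using le by (metis norm_inverse)
    then show ?thesis using le[of c f] False
      by (simp add: field_simps)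
  qed
qed (auto intro!: bcontfun_eqI simp: seq_scale_apply scale_right_distrib scale_left_distrib sm_of_real)

lemma normed_space_over_op_scale:
  "normed_space_over (op_scale sm :: 'k \<Rightarrow> ('z::real_normed_vector \<Rightarrow>\<^sub>L 'x) \<Rightarrow> ('z \<Rightarrow>\<^sub>L 'x))"
proof
  fix c :: 'k and f :: "'z \<Rightarrow>\<^sub>L 'x"
  have le: "norm (op_scale sm c f) \<le> norm c * norm f" for c and f :: "'z \<Rightarrow>\<^sub>L 'x"
  proof (rule norm_blinfun_bound)
    fix x
    show "norm (op_scale sm c f x) \<le> norm c * norm f * norm x"
      by (simp add: op_scale_apply norm_sm mult_left_mono norm_blinfun mult.assoc)
  qed simp
  show "norm (op_scale sm c f) = norm c * norm f"
  proof (cases "c = 0")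
    case True
    then show ?thesis using le[of c f] by simp
  next
    case False
    have "f = op_scale sm (inverse c) (op_scale sm c f)"
      using False by (intro blinfun_eqI) (simp add: op_scale_apply)
    then have "norm f \<le> inverse (norm c) * norm (op_scale sm c f)"
      using le by (metis norm_inverse)
    then show ?thesis using le[of c f] False
      by (simp add: field_simps)
  qed
qed (auto intro!: blinfun_eqI simp: op_scale_apply scale_right_distrib scale_left_distrib sm_of_real
      blinfun.add_left blinfun.scaleR_left)

end

end

theory Submission
  imports Defs
begin

text \<open>
  The isometry is direct: \<open>T\<close> is recovered from \<open>(\<alpha>\<^sub>n)\<close> by \<open>T x = (\<alpha>\<^sub>n x)\<^sub>n\<close>. If \<open>T\<close> is compact, a
  finite net of the image of the unit ball consists of finitely many elements of \<open>c\<^sub>0\<^sub>,\<^sub>I\<close>, which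
  bounds \<open>{n. norm \<alpha>\<^sub>n \<ge> \<epsilon>}\<close> by a finite union of members of \<open>I\<close>.

  For strictness, take unit vectors \<open>x\<^sub>j\<close> and functionals \<open>g\<^sub>j\<close> of norm at most 1
  with \<open>norm (g\<^sub>j x\<^sub>j) \<ge> 1\<close> and \<open>g\<^sub>j x\<^sub>i = 0\<close> for \<open>j < i\<close>; they exist by the Hahn-Banach theorem, as
  finitely many functionals on an infinite-dimensional space have a common zero of norm 1.
  Spread \<open>(g\<^sub>j)\<close> along an infinite member of \<open>I\<close>. The result is in \<open>c\<^sub>0\<^sub>,\<^sub>I(X\<^sup>*)\<close>, but the operator
  it represents maps \<open>(x\<^sub>j)\<close> to a 1-separated sequence.
\<close>

section \<open>The isometry\<close>

lemma Psi_apply_apply: "blinfun_apply (apply_bcontfun (Psi T) n) x = apply_bcontfun (blinfun_apply T x) n"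
  by (simp add: Psi_apply coord_apply)

text \<open>Both norms are the supremum of \<open>norm (T x n)\<close> over all \<open>n\<close> and
  all \<open>x\<close> in the unit ball, taken in the two possible orders.\<close>

lemma norm_Psi: "norm (Psi T) = norm T"
proof (rule antisym)
  show "norm (Psi T) \<le> norm T"
  proof (intro norm_bound norm_blinfun_bound)
    fix n x
    have "norm (Psi T n x) \<le> norm (T x)" by (simp add: Psi_apply_apply norm_bounded)
    also have "\<dots> \<le> norm T * norm x" by (rule norm_blinfun)
    finally show "norm (Psi T n x) \<le> norm T * norm x" .
  qed simp
  show "norm T \<le> norm (Psi T)"
  proof (intro norm_blinfun_bound norm_bound)
    fix x n
    have "norm (T x n) \<le> norm (Psi T n) * norm x"
      using norm_blinfun[of "Psi T n" x] by (simp add: Psi_apply_apply)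
    also have "\<dots> \<le> norm (Psi T) * norm x" by (intro mult_right_mono norm_bounded) auto
    finally show "norm (T x n) \<le> norm (Psi T) * norm x" .
  qed simp
qed

lemma Psi_surj:
  fixes f :: "nat \<Rightarrow>\<^sub>C ('x::real_normed_vector \<Rightarrow>\<^sub>L 'z::real_normed_vector)"
  obtains T where "Psi T = f"
proof -
  \<comment> \<open>This uniform bound makes each \<open>\<lambda>n. f n x\<close> a bounded
    sequence, so \<open>Bcontfun\<close> is specified on it, and also bounds
    \<open>t\<close>.\<close>
  have bd: "norm (f n x) \<le> norm f * norm x" for n x
    using norm_blinfun[of "f n" x] mult_right_mono[OF norm_bounded[of f n], of "norm x"] by simp
  define t where "t x = Bcontfun (\<lambda>n. f n x)" for x
  have t: "t x n = f n x" for x n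
    unfolding t_def using bd by (subst Bcontfun_nat) auto
  have "bounded_linear t"
  proof (rule bounded_linear_intro[where K="norm f"])
    show "norm (t x) \<le> norm x * norm f" for x
      by (rule norm_bound) (use bd in \<open>simp add: t mult.commute\<close>)
  qed (auto intro!: bcontfun_eqI simp: t blinfun.add_right blinfun.scaleR_right)
  then have "Psi (Blinfun t) = f"
    by (intro bcontfun_eqI blinfun_eqI) (simp add: Psi_apply_apply bounded_linear_Blinfun_apply t)
  then show thesis by (rule that)
qed

context normed_space_over
begin

text \<open>Linearity and membership in the target are tested coordinatewise, and coordinate
  \<open>n\<close> of \<open>T x\<close> is \<open>Psi T n x\<close>. This cuts the bijection on all
  operators down to the two subspaces.\<close>

lemma bounded_ops_iff_Psi:
  "T \<in> bounded_ops sm (seq_scale (*)) (c0_ideal I UNIV) \<longleftrightarrow> Psi T \<in> c0_ideal_wstar sm I"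
proof -
  interpret K: normed_space_over "(*) :: 'k \<Rightarrow> 'k \<Rightarrow> 'k" by (rule normed_space_over_times)
  have eq_iff: "f = g \<longleftrightarrow> (\<forall>n. f n = g n)" for f g :: "nat \<Rightarrow>\<^sub>C 'k"
    by (auto intro: bcontfun_eqI)
  have "Vector_Spaces.linear sm (seq_scale (*)) T \<longleftrightarrow> (\<forall>n. Psi T n \<in> dual sm)"
    using vector_space_axioms normed_space_over.axioms(1)[OF normed_space_over_times]
      normed_space_over.axioms(1)[OF K.normed_space_over_seq_scale]
    by (auto simp: dual_def bounded_ops_def Vector_Spaces.linear_iff Psi_apply_apply K.seq_scale_apply
        blinfun.add_right eq_iff)
  then show ?thesis
    by (auto simp: bounded_ops_def c0_ideal_wstar_def c0_ideal_def Psi_apply_apply image_subset_iff)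
qed

lemma onto_linear_isometry_Psi:
  "onto_linear_isometry (op_scale (seq_scale (*))) (seq_scale (op_scale (*)))
     (bounded_ops sm (seq_scale (*)) (c0_ideal I (UNIV :: 'k set))) (c0_ideal_wstar sm I) Psi"
proof -
  interpret K: normed_space_over "(*) :: 'k \<Rightarrow> 'k \<Rightarrow> 'k" by (rule normed_space_over_times)
  interpret S: normed_space_over "seq_scale ((*) :: 'k \<Rightarrow> 'k \<Rightarrow> 'k)"
    by (rule K.normed_space_over_seq_scale)
  interpret D: normed_space_over "op_scale ((*)) :: 'k \<Rightarrow> ('x \<Rightarrow>\<^sub>L 'k) \<Rightarrow> ('x \<Rightarrow>\<^sub>L 'k)"
    by (rule K.normed_space_over_op_scale)
  have "Psi (u + v) = Psi u + Psi v" for u v :: "'x \<Rightarrow>\<^sub>L (nat \<Rightarrow>\<^sub>C 'k)"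
    by (intro bcontfun_eqI blinfun_eqI) (simp add: Psi_apply_apply blinfun.add_left)
  moreover have "Psi (op_scale (seq_scale (*)) c v) = seq_scale (op_scale (*)) c (Psi v)"
    for c and v :: "'x \<Rightarrow>\<^sub>L (nat \<Rightarrow>\<^sub>C 'k)"
    by (intro bcontfun_eqI blinfun_eqI)
      (simp add: Psi_apply_apply S.op_scale_apply K.seq_scale_apply D.seq_scale_apply K.op_scale_apply)
  moreover have "Psi ` bounded_ops sm (seq_scale (*)) (c0_ideal I UNIV) = c0_ideal_wstar sm I"
  proof (intro equalityI subsetI)
    fix f assume f: "f \<in> c0_ideal_wstar sm I"
    obtain T where "Psi T = f" by (rule Psi_surj)
    then show "f \<in> Psi ` bounded_ops sm (seq_scale (*)) (c0_ideal I UNIV)"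
      using f bounded_ops_iff_Psi by blast
  qed (auto simp: bounded_ops_iff_Psi)
  ultimately show ?thesis by (simp add: onto_linear_isometry_def norm_Psi)
qed

end

section \<open>The real Hahn-Banach theorem by minimal sublinear functionals\<close>

section \<open>A norming functional\<close>

text \<open>Homogeneity is only an inequality for positive scalars, which passes easily to infima;
  \<open>sublinear_zero\<close> and \<open>sublinear_scaleR\<close> recover equality for
  \<open>c \<ge> 0\<close>.\<close>

definition sublinear :: "('x::real_vector \<Rightarrow> real) \<Rightarrow> bool" where
  "sublinear q \<longleftrightarrow> (\<forall>x y. q (x + y) \<le> q x + q y) \<and> (\<forall>c>0. \<forall>x. q (c *\<^sub>R x) \<le> c * q x)"

lemma sublinearD:
  assumes "sublinear q"
  shows "q (x + y) \<le> q x + q y" and "c > 0 \<Longrightarrow> q (c *\<^sub>R x) \<le> c * q x"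
  using assms by (auto simp: sublinear_def)

lemma sublinear_zero:
  assumes "sublinear q"
  shows "q 0 = 0"
proof -
  have "q 0 \<le> (1/2) * q 0" using sublinearD(2)[OF assms, of "1/2" 0] by simp
  moreover have "q 0 \<le> q 0 + q 0" using sublinearD(1)[OF assms, of 0 0] by simp
  ultimately show ?thesis by simp
qed

lemma sublinear_scaleR:
  assumes "sublinear q" "c \<ge> 0"
  shows "q (c *\<^sub>R x) = c * q x"
proof (cases "c = 0")
  case True
  then show ?thesis using sublinear_zero[OF assms(1)] by simp
next
  case False
  then have c: "c > 0" using assms by simp
  have "q (inverse c *\<^sub>R (c *\<^sub>R x)) \<le> inverse c * q (c *\<^sub>R x)"
    using c by (intro sublinearD(2)[OF assms(1)]) auto
  then have "c * q x \<le> q (c *\<^sub>R x)" using c by (simp add: field_simps)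
  then show ?thesis using sublinearD(2)[OF assms(1) c, of x] by simp
qed

lemma sublinear_minus:
  assumes "sublinear q"
  shows "- q (- x) \<le> q x"
  using sublinearD(1)[OF assms, of x "- x"] sublinear_zero[OF assms] by simp

text \<open>The infimum of \<open>h y t\<close> over \<open>t \<ge> 0\<close> pushes
  \<open>q\<close> down in the direction \<open>- x0\<close>. Applied to the norm it forces norming
  at \<open>x0\<close>; applied to a minimal functional it forces oddness.\<close>

lemma sublinear_lower:
  fixes q :: "'x::real_vector \<Rightarrow> real"
  assumes q: "sublinear q"
  obtains q' where "sublinear q'" "q' \<le> q" "q' (- x0) \<le> - q x0"
proof -
  define h where "h = (\<lambda>y t. q (y + t *\<^sub>R x0) - t * q x0)"
  define q' where "q' = (\<lambda>y. INF t\<in>{0..}. h y t)"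
  \<comment> \<open>Subadditivity for \<open>t *\<^sub>R x0 = (y + t *\<^sub>R x0) + (- y)\<close>
    bounds \<open>h y\<close> from below, so the infimum is genuine.\<close>
  have bd: "- q (- y) \<le> h y t" if "t \<ge> 0" for y t
    using sublinearD(1)[OF q, of "y + t *\<^sub>R x0" "- y"] sublinear_scaleR[OF q that, of x0]
    by (simp add: h_def)
  have low: "q' y \<le> h y t" if "t \<ge> 0" for y t
    unfolding q'_def using that bd by (intro cINF_lower) (auto simp: bdd_below_def)
  have great: "m \<le> q' y" if "\<And>t. t \<ge> 0 \<Longrightarrow> m \<le> h y t" for m y
    unfolding q'_def using that by (intro cINF_greatest) auto
  have "sublinear q'"
    unfolding sublinear_def
  proof (intro conjI allI impI)
    fix y z
    have "q' (y + z) \<le> h y t + h z s" if "t \<ge> 0" "s \<ge> 0" for s t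
    proof -
      have "q' (y + z) \<le> h (y + z) (t + s)" using that by (intro low) auto
      also have "\<dots> \<le> h y t + h z s"
        using sublinearD(1)[OF q, of "y + t *\<^sub>R x0" "z + s *\<^sub>R x0"]
        by (simp add: h_def algebra_simps)
      finally show ?thesis .
    qed
    \<comment> \<open>The infimum is taken over one parameter at a time: first \<open>s\<close>,
      then \<open>t\<close>.\<close>
    then have "q' (y + z) - h y t \<le> q' z" if "t \<ge> 0" for t
      using that by (intro great) (simp add: algebra_simps)
    then have "q' (y + z) - q' z \<le> q' y"
      by (intro great) (simp add: algebra_simps)
    then show "q' (y + z) \<le> q' y + q' z" by simp
  next
    fix c :: real and y assume c: "c > 0"
    have "q' (c *\<^sub>R y) / c \<le> h y t" if "t \<ge> 0" for t
    proof -
      \<comment> \<open>Rescaling the parameter to \<open>c * t\<close> makes \<open>c\<close> a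
        common factor.\<close>
      have "q' (c *\<^sub>R y) \<le> h (c *\<^sub>R y) (c * t)" using that c by (intro low) auto
      also have "\<dots> \<le> c * h y t"
        using sublinearD(2)[OF q c, of "y + t *\<^sub>R x0"] by (simp add: h_def algebra_simps)
      finally show ?thesis using c by (simp add: field_simps)
    qed
    then have "q' (c *\<^sub>R y) / c \<le> q' y" by (rule great)
    then show "q' (c *\<^sub>R y) \<le> c * q' y" using c by (simp add: field_simps)
  qed
  moreover have "q' \<le> q"
  proof (rule le_funI)
    show "q' y \<le> q y" for y using low[of 0 y] by (simp add: h_def)
  qed
  moreover have "q' (- x0) \<le> - q x0"
    using low[of 1 "- x0"] sublinear_zero[OF q] by (simp add: h_def)
  ultimately show thesis by (rule that)
qed

text \<open>Given two members of the chain, the smaller one bounds both terms in the subadditivity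
  estimate. The common bound \<open>p\<close> keeps the infimum finite, since
  \<open>- p (- x) \<le> q x\<close>.\<close>

lemma sublinear_chain_Inf:
  assumes ne: "C \<noteq> {}" and sub: "\<And>q. q \<in> C \<Longrightarrow> sublinear q \<and> q \<le> p"
    and chain: "\<And>q r. q \<in> C \<Longrightarrow> r \<in> C \<Longrightarrow> q \<le> r \<or> r \<le> q"
  shows "sublinear (\<lambda>x. INF q\<in>C. q x)" and "q \<in> C \<Longrightarrow> (\<lambda>x. INF q\<in>C. q x) \<le> q"
proof -
  let ?m = "\<lambda>x. INF q\<in>C. q x"
  have bd: "- p (- x) \<le> q x" if "q \<in> C" for q x
    using sublinear_minus[of q x] le_funD[of q p "- x"] sub[OF that] by simp
  have low: "?m x \<le> q x" if "q \<in> C" for q x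
    using that bd by (intro cINF_lower) (auto simp: bdd_below_def)
  then show "q \<in> C \<Longrightarrow> ?m \<le> q" by (auto simp: le_fun_def)
  have great: "b \<le> ?m x" if "\<And>q. q \<in> C \<Longrightarrow> b \<le> q x" for b x
    using that ne by (intro cINF_greatest) auto
  show "sublinear ?m"
    unfolding sublinear_def
  proof (intro conjI allI impI)
    fix x y
    have le: "?m (x + y) - q x \<le> r y" if qr: "q \<in> C" "r \<in> C" for q r
    proof -
      obtain s where s: "s \<in> C" "s \<le> q" "s \<le> r" using chain[OF qr] qr by blast
      have "?m (x + y) \<le> s (x + y)" using s(1) by (rule low)
      also have "\<dots> \<le> s x + s y" using sub[OF s(1)] by (simp add: sublinearD(1))
      also have "\<dots> \<le> q x + r y" using s by (intro add_mono) (auto simp: le_fun_def)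
      finally show ?thesis by simp
    qed
    have "?m (x + y) - q x \<le> ?m y" if "q \<in> C" for q
      using le[OF that] by (rule great)
    then have "?m (x + y) - ?m y \<le> ?m x"
      by (intro great) (simp add: algebra_simps)
    then show "?m (x + y) \<le> ?m x + ?m y" by simp
  next
    fix c :: real and x assume c: "c > 0"
    have "?m (c *\<^sub>R x) / c \<le> q x" if "q \<in> C" for q
      using low[OF that, of "c *\<^sub>R x"] sublinearD(2)[of q c x] sub[OF that] c
      by (auto simp: field_simps)
    then have "?m (c *\<^sub>R x) / c \<le> ?m x" by (rule great)
    then show "?m (c *\<^sub>R x) \<le> c * ?m x" using c by (simp add: field_simps)
  qed
qed

text \<open>A minimal sublinear functional is odd by \<open>sublinear_lower\<close>, hence linear.\<close>

theorem sublinear_dominates_linear: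
  fixes p :: "'x::real_vector \<Rightarrow> real"
  assumes p: "sublinear p"
  obtains q where "linear q" "q \<le> p"
proof -
  define A where "A = {q. sublinear q \<and> q \<le> p}"
  \<comment> \<open>The order is reversed, so the maximal element from Zorn's lemma is a minimal
    functional.\<close>
  define P where "P = (\<lambda>q r :: 'x \<Rightarrow> real. r \<le> q)"
  have "\<exists>m\<in>A. \<forall>a\<in>A. P m a \<longrightarrow> a = m"
  proof (rule predicate_Zorn)
    show "partial_order_on A (relation_of P A)"
      unfolding P_def by (rule partial_order_on_relation_ofI) auto
  next
    fix C assume C: "C \<in> Chains (relation_of P A)"
    then have CA: "\<And>q. q \<in> C \<Longrightarrow> sublinear q \<and> q \<le> p"
      and ch: "\<And>q r. q \<in> C \<Longrightarrow> r \<in> C \<Longrightarrow> q \<le> r \<or> r \<le> q"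
      by (auto simp: Chains_def relation_of_def A_def P_def)
    show "\<exists>u\<in>A. \<forall>a\<in>C. P a u"
    proof (cases "C = {}")
      case True
      then show ?thesis using p by (auto simp: A_def)
    next
      case False
      note m = sublinear_chain_Inf[OF False CA ch]
      obtain q where "q \<in> C" using False by blast
      then have "(\<lambda>x. INF q\<in>C. q x) \<le> p" using m(2)[of q] CA[of q] by (blast intro: order_trans)
      then show ?thesis using m unfolding A_def P_def by blast
    qed
  qed
  then obtain q where q: "sublinear q" "q \<le> p"
    and min: "\<And>r. sublinear r \<Longrightarrow> r \<le> q \<Longrightarrow> r = q"
    unfolding A_def P_def by (auto intro: order_trans)
  \<comment> \<open>By minimality the lowered functional \<open>r\<close> is \<open>q\<close>
    itself, so \<open>q (- x) \<le> - q x\<close>; \<open>sublinear_minus\<close> is the other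
    inequality.\<close>
  have odd: "q (- x) = - q x" for x
  proof -
    obtain r where "sublinear r" "r \<le> q" "r (- x) \<le> - q x"
      using sublinear_lower[OF q(1)] by blast
    then show ?thesis using min[of r] sublinear_minus[OF q(1), of x] by force
  qed
  have "linear q"
  proof (rule linearI)
    fix x y
    show "q (x + y) = q x + q y"
      using sublinearD(1)[OF q(1), of x y] sublinearD(1)[OF q(1), of "- x" "- y"] odd[of "x + y"]
      by (simp add: odd)
  next
    fix c :: real and x
    show "q (c *\<^sub>R x) = c *\<^sub>R q x"
      using sublinear_scaleR[OF q(1), of c x] sublinear_scaleR[OF q(1), of "- c" "x"] odd[of "c *\<^sub>R x"]
      by (cases "c \<ge> 0") auto
  qed
  then show thesis using q(2) by (rule that)
qed

text \<open>The norm is first lowered so that its value at \<open>- x0\<close> is at most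
  \<open>- norm x0\<close>. Any linear \<open>u\<close> below the result then satisfies
  \<open>u x0 \<ge> norm x0\<close>.\<close>

corollary real_norming_functional:
  fixes x0 :: "'x::real_normed_vector"
  obtains u :: "'x \<Rightarrow> real" where "linear u" "\<And>x. \<bar>u x\<bar> \<le> norm x" "u x0 = norm x0"
proof -
  have "sublinear (norm :: 'x \<Rightarrow> real)"
    by (auto simp: sublinear_def norm_triangle_ineq)
  then obtain p where p: "sublinear p" "p \<le> norm" "p (- x0) \<le> - norm x0"
    by (rule sublinear_lower)
  obtain u where u: "linear u" "u \<le> p" using sublinear_dominates_linear[OF p(1)] .
  have le: "u x \<le> norm x" for x using order_trans[OF le_funD[OF u(2)] le_funD[OF p(2)]] .
  have "\<bar>u x\<bar> \<le> norm x" for x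
    using le[of x] le[of "- x"] by (simp add: linear_neg[OF u(1)])
  moreover have "norm x0 \<le> u x0"
    using le_funD[OF u(2), of "- x0"] p(3) linear_neg[OF u(1), of x0] by simp
  ultimately show thesis using u(1) le[of x0] by (intro that[of u]) auto
qed

text \<open>
  The form \<open>(k, a) \<mapsto> (k * a) \<bullet> 1\<close> is nondegenerate, so it identifies \<open>'k\<close> with its real dual.
\<close>

lemma real_functional_representation:
  fixes w :: "'k::{real_normed_field,euclidean_space} \<Rightarrow> real"
  assumes w: "linear w"
  shows "\<exists>!a. \<forall>k. (k * a) \<bullet> 1 = w k"
proof -
  \<comment> \<open>For nonzero \<open>a\<close>, the choice \<open>k = inverse a\<close> would give
    \<open>1 \<bullet> 1 = 0\<close>.\<close>
  have eq0: "a = 0" if "\<And>k. (k * a) \<bullet> 1 = 0" for a :: 'k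
    using that[of "inverse a"] by (cases "a = 0") auto
  \<comment> \<open>\<open>L a\<close> is the Riesz vector of
    \<open>\<lambda>k. (k * a) \<bullet> 1\<close>. Being an injective endomorphism in finite
    dimension, \<open>L\<close> is onto, so every real functional has this form.\<close>
  define L where "L a = (\<Sum>b\<in>Basis. ((b * a) \<bullet> 1) *\<^sub>R b)" for a :: 'k
  have "linear L"
    unfolding L_def
    by (intro linear_compose_sum ballI linearI)
      (auto simp: algebra_simps inner_add_left scaleR_left_distrib)
  have rep: "f k = g k" if "linear f" "linear g" "\<And>b. b \<in> Basis \<Longrightarrow> f b = g b"
    for f g :: "'k \<Rightarrow> real" and k
    using linear_eq_on[OF that(1,2), of k Basis] that(3) by (simp add: span_Basis)
  have lin: "linear (\<lambda>k. (k * a) \<bullet> 1)" for a :: 'k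
    by (rule linearI) (auto simp: algebra_simps inner_add_left)
  have Lb: "L a \<bullet> b = (b * a) \<bullet> 1" if "b \<in> Basis" for a b
    using that by (simp add: L_def inner_sum_left_Basis)
  have "inj L"
    unfolding linear_injective_0[OF \<open>linear L\<close>]
  proof (intro allI impI)
    fix a assume "L a = 0"
    then have "(b * a) \<bullet> 1 = 0" if "b \<in> Basis" for b using Lb[OF that, of a] by simp
    then have "(k * a) \<bullet> 1 = 0" for k
      using rep[OF lin[of a] linear_zero] by simp
    then show "a = 0" by (rule eq0)
  qed
  then have "surj L" using linear_injective_imp_surjective[OF \<open>linear L\<close>] by simp
  then obtain a where "L a = (\<Sum>b\<in>Basis. w b *\<^sub>R b)" by (metis surjD)
  then have "(b * a) \<bullet> 1 = w b" if "b \<in> Basis" for b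
    using Lb[OF that, of a] that by (simp add: inner_sum_left_Basis)
  then have "\<forall>k. (k * a) \<bullet> 1 = w k" using rep[OF lin w] by blast
  moreover have "a = a'" if "\<forall>k. (k * a) \<bullet> 1 = w k" "\<forall>k. (k * a') \<bullet> 1 = w k" for a a'
    using eq0[of "a - a'"] that by (simp add: algebra_simps inner_diff_left)
  ultimately show ?thesis by blast
qed

section \<open>Lifting real functionals to the scalar field \<open>'k\<close>\<close>

context normed_space_over
begin

lemma linear_sm_right: "linear u \<Longrightarrow> linear (\<lambda>k. u (sm k x))"
  for u :: "'x \<Rightarrow> real"
proof (rule linearI)
  fix r k
  assume u: "linear u"
  have "sm (r *\<^sub>R k) x = r *\<^sub>R sm k x"
    by (metis sm_of_real scale_scale scaleR_conv_of_real)
  then show "u (sm (r *\<^sub>R k) x) = r *\<^sub>R u (sm k x)" using u by (simp add: linear_cmul)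
qed (simp add: scale_left_distrib linear_add)

text \<open>\<open>f x\<close> is the unique scalar representing
  \<open>\<lambda>k. u (sm k x)\<close>; over the complex numbers this is the usual
  \<open>u x - i u (i x)\<close>. Uniqueness makes \<open>f\<close> linear over
  \<open>'k\<close>.\<close>

lemma norming_functional:
  obtains g where "g \<in> dual sm" "norm g \<le> 1" "norm (blinfun_apply g x0) \<ge> norm x0"
proof -
  obtain u :: "'x \<Rightarrow> real" where u: "linear u" "\<And>x. \<bar>u x\<bar> \<le> norm x" "u x0 = norm x0"
    using real_norming_functional[of x0] by blast
  have ex1: "\<exists>!a. \<forall>k. (k * a) \<bullet> 1 = u (sm k x)" for x
    using real_functional_representation[OF linear_sm_right[OF u(1)]] .
  then obtain f where f: "\<And>x k. (k * f x) \<bullet> 1 = u (sm k x)" by metis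
  have uniq: "f x = a" if "\<And>k. (k * a) \<bullet> 1 = u (sm k x)" for x a
    using ex1[of x] f that by blast
  have add: "f (x + y) = f x + f y" for x y
    by (rule uniq) (simp add: distrib_left inner_add_left f scale_right_distrib linear_add[OF u(1)])
  have scale: "f (sm c x) = c * f x" for c x
    by (rule uniq) (simp add: f flip: mult.assoc)
  have nf: "norm (f x) \<le> norm x" for x
  proof (cases "f x = 0")
    case False
    have "(1::'k) \<bullet> 1 = 1" by (simp add: dot_square_norm)
    \<comment> \<open>Testing with \<open>k = inverse (f x)\<close> turns \<open>k * f x\<close>
      into 1, and the bound on \<open>u\<close> gives the one on \<open>f\<close>.\<close>
    then have "1 = u (sm (inverse (f x)) x)" using f[of "inverse (f x)" x] False by simp
    also have "\<dots> \<le> norm x / norm (f x)"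
      using u(2)[of "sm (inverse (f x)) x"] by (simp add: norm_sm norm_inverse divide_inverse mult.commute)
    finally show ?thesis using False by (simp add: field_simps)
  qed simp
  have "bounded_linear f"
  proof (rule bounded_linear_intro[where K=1])
    show "f (r *\<^sub>R x) = r *\<^sub>R f x" for r x
      by (metis scale sm_of_real scaleR_conv_of_real)
  qed (auto simp: add nf)
  then have ap: "blinfun_apply (Blinfun f) = f" by (rule bounded_linear_Blinfun_apply)
  show thesis
  proof (rule that[of "Blinfun f"])
    show "Blinfun f \<in> dual sm"
      using add scale normed_space_over_times vector_space_axioms
      by (auto simp: dual_def bounded_ops_def ap Vector_Spaces.linear_iff normed_space_over_def)
    show "norm (Blinfun f) \<le> 1" by (rule norm_blinfun_bound) (auto simp: ap nf)
    have "norm x0 = f x0 \<bullet> 1" using f[of 1 x0] u(3) by simp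
    also have "\<dots> \<le> norm (f x0)" using norm_cauchy_schwarz[of "f x0" 1] by simp
    finally show "norm (Blinfun f x0) \<ge> norm x0" by (simp add: ap)
  qed
qed

lemma dual_linear:
  assumes "g \<in> dual sm"
  shows "blinfun_apply g (sm c x) = c * blinfun_apply g x"
  using assms by (auto simp: dual_def bounded_ops_def Vector_Spaces.linear_iff)

section \<open>Triangular sequences of functionals\<close>

text \<open>The common kernel has finite codimension: each new functional either vanishes on the
  previous common kernel or costs one more spanning vector \<open>y\<close>.\<close>

lemma finite_codim_kernels:
  fixes g :: "nat \<Rightarrow> 'x \<Rightarrow>\<^sub>L 'k"
  assumes "\<And>i. i < n \<Longrightarrow> g i \<in> dual sm"
  shows "\<exists>B. finite B \<and> (\<forall>x. \<exists>z\<in>span B. \<forall>i<n. g i (x - z) = 0)"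
  using assms
proof (induction n)
  case 0
  show ?case by (intro exI[of _ "{}"]) auto
next
  case (Suc n)
  have "\<exists>B. finite B \<and> (\<forall>x. \<exists>z\<in>span B. \<forall>i<n. g i (x - z) = 0)"
    by (rule Suc.IH) (simp add: Suc.prems)
  then obtain B where B: "finite B" "\<And>x. \<exists>z\<in>span B. \<forall>i<n. g i (x - z) = 0"
    by auto
  have sm: "\<And>i c x. i \<le> n \<Longrightarrow> g i (sm c x) = c * g i x"
    using Suc.prems by (simp add: dual_linear less_Suc_eq_le)
  show ?case
  proof (cases "\<exists>y. (\<forall>i<n. g i y = 0) \<and> g n y \<noteq> 0")
    case False
    then show ?thesis using B by (metis less_Suc_eq)
  next
    case True
    then obtain y where y: "\<And>i. i < n \<Longrightarrow> g i y = 0" "g n y \<noteq> 0" by blast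
    have "\<exists>z\<in>span (insert y B). \<forall>i<Suc n. g i (x - z) = 0" for x
    proof -
      obtain z where z: "z \<in> span B" "\<And>i. i < n \<Longrightarrow> g i (x - z) = 0" using B(2) by blast
      \<comment> \<open>The coefficient cancels \<open>g n (x - z)\<close>; the earlier functionals
        vanish at \<open>y\<close> and are undisturbed.\<close>
      let ?z = "z + sm (g n (x - z) / g n y) y"
      have "?z \<in> span (insert y B)"
        using z(1) span_mono[of B "insert y B"] by (intro span_add span_scale) (auto intro: span_base)
      moreover have "g i (x - ?z) = 0" if "i < Suc n" for i
      proof -
        have "g i (x - ?z) = g i (x - z) - (g n (x - z) / g n y) * g i y"
          using that sm[of i] by (simp add: blinfun.diff_right blinfun.add_right)
        then show ?thesis using that y z(2) by (cases "i = n") auto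
      qed
      ultimately show ?thesis by blast
    qed
    then show ?thesis using B(1) by (intro exI[of _ "insert y B"]) auto
  qed
qed

lemma common_zero:
  fixes g :: "nat \<Rightarrow> 'x \<Rightarrow>\<^sub>L 'k"
  assumes "infinite_dim sm" "\<And>i. i < n \<Longrightarrow> g i \<in> dual sm"
  obtains x where "norm x = 1" "\<And>i. i < n \<Longrightarrow> g i x = 0"
proof -
  obtain B where B: "finite B" "\<And>x. \<exists>z\<in>span B. \<forall>i<n. g i (x - z) = 0"
    using finite_codim_kernels[of n g] assms(2) by metis
  obtain x where x: "x \<notin> span B" using assms(1) B(1) by (auto simp: infinite_dim_def)
  obtain z where z: "z \<in> span B" "\<forall>i<n. g i (x - z) = 0" using B(2) by blast
  then have "x - z \<noteq> 0" using x by auto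
  then show thesis using z(2)
    by (intro that[of "(1 / norm (x - z)) *\<^sub>R (x - z)"]) (simp_all add: blinfun.scaleR_right)
qed

lemma triangular_sequence:
  assumes "infinite_dim sm"
  obtains x :: "nat \<Rightarrow> 'x" and g :: "nat \<Rightarrow> 'x \<Rightarrow>\<^sub>L 'k"
  where "\<And>n. norm (x n) = 1" "\<And>n. g n \<in> dual sm" "\<And>n. norm (g n) \<le> 1"
    "\<And>n. norm (g n (x n)) \<ge> 1" "\<And>i n. i < n \<Longrightarrow> g i (x n) = 0"
proof -
  \<comment> \<open>A pair \<open>r\<close> at stage \<open>n\<close> refers only to earlier pairs:
    first \<open>x\<close> is a common zero of the previous functionals, then \<open>g\<close> is
    chosen to norm it.\<close>
  define P where "P = (\<lambda>(f :: nat \<Rightarrow> 'x \<times> ('x \<Rightarrow>\<^sub>L 'k)) n r. norm (fst r) = 1 \<and> snd r \<in> dual sm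
    \<and> norm (snd r) \<le> 1 \<and> norm (blinfun_apply (snd r) (fst r)) \<ge> 1
    \<and> (\<forall>i<n. blinfun_apply (snd (f i)) (fst r) = 0))"
  have "\<exists>f. \<forall>n. P f n (f n)"
  proof (rule dependent_wellorder_choice)
    fix n and f :: "nat \<Rightarrow> 'x \<times> ('x \<Rightarrow>\<^sub>L 'k)"
    assume "\<And>i. i < n \<Longrightarrow> P f i (f i)"
    then obtain x where x: "norm x = 1" "\<And>i. i < n \<Longrightarrow> blinfun_apply (snd (f i)) x = 0"
      using common_zero[OF assms, of n "\<lambda>i. snd (f i)"] by (auto simp: P_def)
    obtain g where "g \<in> dual sm" "norm g \<le> 1" "norm (blinfun_apply g x) \<ge> norm x"
      using norming_functional[of x] .
    then show "\<exists>r. P f n r" using x by (intro exI[of _ "(x, g)"]) (auto simp: P_def)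
  qed (simp add: P_def)
  then obtain f where "\<And>n. P f n (f n)" by blast
  then show thesis by (intro that[of "fst \<circ> f" "snd \<circ> f"]) (auto simp: P_def)
qed

section \<open>Compact operators\<close>

lemma Psi_compact_in_c0_ideal:
  assumes I: "ideal_on_nat I" and T: "T \<in> compact_ops sm (seq_scale (*)) (c0_ideal I (UNIV :: 'k set))"
  shows "Psi T \<in> c0_ideal I (dual sm)"
proof -
  let ?Y = "c0_ideal I (UNIV :: 'k set)"
  let ?C = "?Y \<inter> closure (blinfun_apply T ` cball 0 1)"
  have T1: "T \<in> bounded_ops sm (seq_scale (*)) ?Y" and C: "compact ?C"
    using T by (auto simp: compact_ops_def)
  have "Psi T n \<in> dual sm" for n
    using T1 unfolding bounded_ops_iff_Psi by (simp add: c0_ideal_wstar_def)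
  moreover have "{n. norm (Psi T n) \<ge> \<epsilon>} \<in> I" if "\<epsilon> > 0" for \<epsilon>
  proof -
    \<comment> \<open>The centres lie in \<open>?C\<close> itself, hence in \<open>?Y\<close>, so
      each has its large coordinates in \<open>I\<close>.\<close>
    obtain F where F: "finite F" "F \<subseteq> ?C" "?C \<subseteq> (\<Union>y\<in>F. ball y (\<epsilon> / 3))"
      using seq_compact_imp_totally_bounded[OF compact_imp_seq_compact[OF C]] \<open>\<epsilon> > 0\<close>
      by (meson divide_pos_pos zero_less_numeral)
    have "{n. norm (Psi T n) \<ge> \<epsilon>} \<subseteq> (\<Union>y\<in>F. {n. norm (apply_bcontfun y n) \<ge> \<epsilon> / 3})"
    proof
      fix n assume n: "n \<in> {n. norm (Psi T n) \<ge> \<epsilon>}"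
      \<comment> \<open>The operator norm need not be attained, hence the threshold
        \<open>2 * \<epsilon> / 3\<close> below \<open>\<epsilon>\<close>; a centre within
        \<open>\<epsilon> / 3\<close> still has coordinate at least
        \<open>\<epsilon> / 3\<close>.\<close>
      obtain x where x: "norm x \<le> 1" "norm (T x n) > 2 * \<epsilon> / 3"
      proof (rule ccontr)
        assume "\<not> thesis"
        then have le: "norm x \<le> 1 \<Longrightarrow> norm (T x n) \<le> 2 * \<epsilon> / 3" for x
          using that by (meson not_le)
        have "norm (Psi T n x) \<le> 2 * \<epsilon> / 3 * norm x" for x
        proof (cases "x = 0")
          case False
          have "norm (Psi T n ((1 / norm x) *\<^sub>R x)) \<le> 2 * \<epsilon> / 3"
            unfolding Psi_apply_apply using False by (intro le) simp
          then show ?thesis using False by (simp add: blinfun.scaleR_right field_simps)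
        qed simp
        then have "norm (Psi T n) \<le> 2 * \<epsilon> / 3" using \<open>\<epsilon> > 0\<close> by (intro norm_blinfun_bound) auto
        then show False using n \<open>\<epsilon> > 0\<close> by simp
      qed
      have "T x \<in> ?C"
        using T1 x(1) by (auto simp: bounded_ops_def intro!: subsetD[OF closure_subset])
      then obtain y where y: "y \<in> F" "dist y (T x) < \<epsilon> / 3" using F(3) by auto
      have "dist (y n) (T x n) < \<epsilon> / 3"
        using dist_bounded[of y n "T x"] y(2) by simp
      then have "norm (y n) \<ge> \<epsilon> / 3"
        using x(2) norm_triangle_ineq2[of "T x n" "y n"] by (simp add: dist_norm norm_minus_commute)
      then show "n \<in> (\<Union>y\<in>F. {n. norm (apply_bcontfun y n) \<ge> \<epsilon> / 3})" using y(1) by blast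
    qed
    moreover have "(\<Union>y\<in>F. {n. norm (apply_bcontfun y n) \<ge> \<epsilon> / 3}) \<in> I"
      using F(1,2)
    proof (induction F)
      case empty
      then show ?case using I by (simp add: ideal_on_nat_def)
    next
      case (insert y F)
      then have "\<forall>\<delta>>0. {n. norm (apply_bcontfun y n) \<ge> \<delta>} \<in> I" by (auto simp: c0_ideal_def)
      then have "{n. norm (apply_bcontfun y n) \<ge> \<epsilon> / 3} \<in> I"
        using \<open>\<epsilon> > 0\<close> by (meson divide_pos_pos zero_less_numeral)
      then show ?case using insert I by (simp add: ideal_on_nat_def)
    qed
    ultimately show ?thesis using I unfolding ideal_on_nat_def by blast
  qed
  ultimately show ?thesis by (simp add: c0_ideal_def)
qed

lemma c0_ideal_not_compact:
  assumes dim: "infinite_dim sm" and I: "ideal_on_nat I" and A: "A \<in> I" "infinite A"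
  obtains f where "f \<in> c0_ideal I (dual sm)"
    "f \<notin> Psi ` compact_ops sm (seq_scale (*)) (c0_ideal I (UNIV :: 'k set))"
proof -
  obtain x :: "nat \<Rightarrow> 'x" and g :: "nat \<Rightarrow> 'x \<Rightarrow>\<^sub>L 'k"
    where x: "\<And>n. norm (x n) = 1" and g: "\<And>n. g n \<in> dual sm" "\<And>n. norm (g n) \<le> 1"
      "\<And>n. norm (g n (x n)) \<ge> 1" "\<And>i n. i < n \<Longrightarrow> g i (x n) = 0"
    using triangular_sequence[OF dim] by metis
  define e where "e = enumerate A"
  have e: "inj e" "range e = A"
    using A(2) bij_enumerate[of A] by (auto simp: e_def bij_betw_def)
  \<comment> \<open>\<open>g j\<close> sits at the \<open>j\<close>-th element of \<open>A\<close>,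
    with zero elsewhere, so every set of large norms is contained in \<open>A\<close>.\<close>
  define h where "h n = (if n \<in> A then g (inv e n) else 0)" for n
  define f where "f = Bcontfun h"
  have f: "f n = h n" for n
    unfolding f_def by (subst Bcontfun_nat[where b=1]) (auto simp: h_def g)
  have fe: "f (e n) = g n" for n using e by (auto simp: f h_def)
  have "0 \<in> dual sm"
    using vector_space_axioms normed_space_over.axioms(1)[OF normed_space_over_times]
    by (auto simp: dual_def bounded_ops_def Vector_Spaces.linear_iff)
  moreover have "{n. norm (f n) \<ge> \<epsilon>} \<in> I" if "\<epsilon> > 0" for \<epsilon>
  proof -
    have "{n. norm (f n) \<ge> \<epsilon>} \<subseteq> A" using that by (auto simp: f h_def split: if_splits)
    then show ?thesis using I A(1) unfolding ideal_on_nat_def by blast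
  qed
  ultimately have "f \<in> c0_ideal I (dual sm)"
    using g(1) by (auto simp: c0_ideal_def f h_def)
  moreover have "f \<notin> Psi ` compact_ops sm (seq_scale (*)) (c0_ideal I (UNIV :: 'k set))"
  proof
    let ?Y = "c0_ideal I (UNIV :: 'k set)"
    assume "f \<in> Psi ` compact_ops sm (seq_scale (*)) ?Y"
    then obtain T where fT: "f = Psi T" and T: "range (blinfun_apply T) \<subseteq> ?Y"
      and C: "compact (?Y \<inter> closure (blinfun_apply T ` cball 0 1))"
      by (auto simp: compact_ops_def bounded_ops_def)
    have "T (x n) \<in> ?Y \<inter> closure (blinfun_apply T ` cball 0 1)" for n
      using T x by (auto intro!: subsetD[OF closure_subset])
    then obtain l r where r: "strict_mono r" "((\<lambda>n. T (x n)) \<circ> r) \<longlonglongrightarrow> l"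
      using C unfolding compact_def by metis
    have "Cauchy ((\<lambda>n. T (x n)) \<circ> r)" using r(2) by (rule LIMSEQ_imp_Cauchy)
    then obtain N where N: "\<And>m n. m \<ge> N \<Longrightarrow> n \<ge> N \<Longrightarrow> dist (T (x (r m))) (T (x (r n))) < 1"
      unfolding Cauchy_def by (metis comp_apply zero_less_one)
    \<comment> \<open>Coordinate \<open>e (r N)\<close> separates the two images: it is
      \<open>g (r N) (x (r N))\<close>, of norm at least 1, on the first and 0 on the second by
      triangularity.\<close>
    have "r N < r (Suc N)" using r(1) by (simp add: strict_mono_Suc_iff)
    moreover have ap: "T (x m) (e n) = g n (x m)" for m n
      using Psi_apply_apply[of T "e n" "x m"] fe[of n] fT by simp
    ultimately have "norm (g (r N) (x (r N))) = dist (T (x (r N)) (e (r N))) (T (x (r (Suc N))) (e (r N)))"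
      using g(4) by simp
    also have "\<dots> \<le> dist (T (x (r N))) (T (x (r (Suc N))))" by (rule dist_bounded)
    also have "\<dots> < 1" by (rule N) auto
    finally show False using g(3)[of "r N"] by simp
  qed
  ultimately show thesis by (rule that)
qed

end

theorem theorem5p2:
  fixes sm :: "'k::{real_normed_field,euclidean_space} \<Rightarrow> 'x::banach \<Rightarrow> 'x"
    and I :: "nat set set"
  assumes "normed_space_over sm"
    and "ideal_on_nat I"
  shows "onto_linear_isometry (op_scale (seq_scale (*))) (seq_scale (op_scale (*)))
           (bounded_ops sm (seq_scale (*)) (c0_ideal I (UNIV :: 'k set)))
           (c0_ideal_wstar sm I)
           Psi
         \<and> (infinite_dim sm \<and> I \<noteq> {A. finite A} \<longrightarrow>
           Psi ` compact_ops sm (seq_scale (*)) (c0_ideal I (UNIV :: 'k set))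
             \<subset> c0_ideal I (dual sm))"
proof (intro conjI impI)
  interpret normed_space_over sm by fact
  show "onto_linear_isometry (op_scale (seq_scale (*))) (seq_scale (op_scale (*)))
     (bounded_ops sm (seq_scale (*)) (c0_ideal I (UNIV :: 'k set))) (c0_ideal_wstar sm I) Psi"
    by (rule onto_linear_isometry_Psi)
  assume *: "infinite_dim sm \<and> I \<noteq> {A. finite A}"
  \<comment> \<open>Since \<open>I\<close> contains all finite sets, differing from them means
    having an infinite member.\<close>
  then obtain A where "A \<in> I" "infinite A"
    using assms(2) by (auto simp: ideal_on_nat_def)
  then obtain f where "f \<in> c0_ideal I (dual sm)"
    "f \<notin> Psi ` compact_ops sm (seq_scale (*)) (c0_ideal I (UNIV :: 'k set))"
    using c0_ideal_not_compact * assms(2) by metis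
  then show "Psi ` compact_ops sm (seq_scale (*)) (c0_ideal I (UNIV :: 'k set)) \<subset> c0_ideal I (dual sm)"
    using Psi_compact_in_c0_ideal[OF assms(2)] by blast
qed

end
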